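(* Let $n\ge 4$. For $\mathbf{D}_n^{(n)}$ there are exactly two orbits of labelings: 1. the orbit of zero, which consists of the labelings with an odd number of components (including the component of the boxed 1), with the zero labeling as a representative; 2. the other orbit, which consists of the labelings with an even number of components (including the component of the boxed 1), with representative the labeling with $a_1=1$ and $a_i=0$ for $2\le i\le n$.
   Context: $\mathbf{D}_n^{(n)}$ is the Dynkin diagram $\mathbf{D}_n$ with vertices $1,\dots,n$, edges $\{i,i+1\}$ for $1\le i\le n-2$ and the edge $\{n-2,n\}$, with vertex $n$ colored black. A labeling is $\boldsymbol a=(a_1,\dots,a_n)\in(\mathbb{Z}/2\mathbb{Z})^n$. The augmented diagram is obtained by adding one extra vertex (the "boxed 1"), joined by an edge to vertex $n$ only, carrying the constant label $1$. For $1\le i\le n$ the move $\mathcal{M}_i$ changes only $a_i$, replacing it by $a_i$ plus the sum (in $\mathbb{Z}/2\mathbb{Z}$) of the labels of all neighbors of $i$ in the augmented diagram (including the boxed 1 when $i=n$). There is no move at the boxed vertex. Orbits are the equivalence classes of labelings under finite sequences of moves. Components of a labeling are the connected components of the subgraph of the augmented diagram induced on the vertices with label $1$, the boxed vertex included. *)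

theory Defs
  imports Main "HOL-Library.FuncSet" "HOL-Library.Z2"
begin

text \<open>
  The vertices of the diagram are \<open>1, \<dots>, n\<close>; the boxed vertex is encoded as \<open>0\<close>.
  Edges are unordered pairs of vertices.  The truncated subtraction \<open>n - 2\<close> is harmless since
  everything is used for \<open>n \<ge> 4\<close> only.
\<close>

definition D_edges :: "nat \<Rightarrow> nat set set" where
  "D_edges n = {{i, i + 1} | i. 1 \<le> i \<and> i \<le> n - 2} \<union> {{n - 2, n}}"

definition aug_edges :: "nat \<Rightarrow> nat set set" where
  "aug_edges n = D_edges n \<union> {{0, n}}"

definition neighbors :: "nat \<Rightarrow> nat \<Rightarrow> nat set" where
  "neighbors n i = {j \<in> {0..n}. {i, j} \<in> aug_edges n}"

definition labelings :: "nat \<Rightarrow> (nat \<Rightarrow> bit) set" where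
  "labelings n = ({1..n} \<rightarrow>\<^sub>E UNIV)"

definition aug_label :: "(nat \<Rightarrow> bit) \<Rightarrow> nat \<Rightarrow> bit" where
  "aug_label a v = (if v = 0 then 1 else a v)"

definition move :: "nat \<Rightarrow> nat \<Rightarrow> (nat \<Rightarrow> bit) \<Rightarrow> nat \<Rightarrow> bit" where
  "move n i a = a(i := a i + (\<Sum>j\<in>neighbors n i. aug_label a j))"

definition move_rel :: "nat \<Rightarrow> ((nat \<Rightarrow> bit) \<times> (nat \<Rightarrow> bit)) set" where
  "move_rel n = {(a, move n i a) | a i. a \<in> labelings n \<and> i \<in> {1..n}}"

definition orbit_rel :: "nat \<Rightarrow> ((nat \<Rightarrow> bit) \<times> (nat \<Rightarrow> bit)) set" where
  "orbit_rel n = (move_rel n)\<^sup>* \<inter> labelings n \<times> labelings n"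

definition orbit :: "nat \<Rightarrow> (nat \<Rightarrow> bit) \<Rightarrow> (nat \<Rightarrow> bit) set" where
  "orbit n a = orbit_rel n `` {a}"

definition orbits :: "nat \<Rightarrow> (nat \<Rightarrow> bit) set set" where
  "orbits n = labelings n // orbit_rel n"

definition one_vertices :: "nat \<Rightarrow> (nat \<Rightarrow> bit) \<Rightarrow> nat set" where
  "one_vertices n a = {v \<in> {0..n}. aug_label a v = 1}"

definition induced_adj :: "nat \<Rightarrow> nat set \<Rightarrow> (nat \<times> nat) set" where
  "induced_adj n S = {(u, v). u \<in> S \<and> v \<in> S \<and> {u, v} \<in> aug_edges n}"

definition components :: "nat \<Rightarrow> (nat \<Rightarrow> bit) \<Rightarrow> nat set set" where
  "components n a = one_vertices n a // (induced_adj n (one_vertices n a))\<^sup>*"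

definition zero_labeling :: "nat \<Rightarrow> nat \<Rightarrow> bit" where
  "zero_labeling n = (\<lambda>i\<in>{1..n}. 0)"

definition first_labeling :: "nat \<Rightarrow> nat \<Rightarrow> bit" where
  "first_labeling n = (\<lambda>i\<in>{1..n}. if i = 1 then 1 else 0)"

text \<open>
  Each move is an involution (for \<open>n > 0\<close> the augmented diagram has no loops), so reachability
  by finite sequences of moves is an equivalence relation and \<^const>\<open>orbits\<close> is its quotient.
\<close>

lemma move_in_labelings:
  "a \<in> labelings n \<Longrightarrow> i \<in> {1..n} \<Longrightarrow> move n i a \<in> labelings n"
  by (auto simp: labelings_def move_def PiE_def extensional_def)

lemma not_self_neighbor: "n > 0 \<Longrightarrow> i \<notin> neighbors n i"
  by (auto simp: neighbors_def aug_edges_def D_edges_def doubleton_eq_iff)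

lemma move_move:
  assumes "n > 0"
  shows "move n i (move n i a) = a"
proof -
  define s where "s = (\<Sum>j\<in>neighbors n i. aug_label a j)"
  have m: "move n i a = a(i := a i + s)"
    by (simp add: move_def s_def)
  have "(\<Sum>j\<in>neighbors n i. aug_label (a(i := a i + s)) j) = s"
    unfolding s_def
    by (rule sum.cong) (use not_self_neighbor[OF assms, of i] in \<open>auto simp: aug_label_def\<close>)
  then have "move n i (a(i := a i + s)) = a(i := a i + s + s)"
    by (simp only: move_def fun_upd_same fun_upd_upd)
  moreover have "a i + s + s = a i"
    by (cases "a i"; cases s) simp_all
  ultimately show ?thesis
    by (simp only: m fun_upd_triv)
qed

lemma equiv_orbit_rel:
  assumes "n > 0"
  shows "equiv (labelings n) (orbit_rel n)"
proof -
  have "sym (move_rel n)"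
  proof (rule symI)
    fix a b
    assume "(a, b) \<in> move_rel n"
    then obtain i where i: "a \<in> labelings n" "i \<in> {1..n}" "b = move n i a"
      unfolding move_rel_def by blast
    then have "a = move n i b" "b \<in> labelings n"
      using move_move[OF assms] move_in_labelings by simp_all
    with i(2) show "(b, a) \<in> move_rel n"
      unfolding move_rel_def by blast
  qed
  then have "sym ((move_rel n)\<^sup>*)"
    by (rule sym_rtrancl)
  then have "sym (orbit_rel n)"
    unfolding orbit_rel_def sym_def by blast
  moreover have "trans (orbit_rel n)"
    unfolding orbit_rel_def by (rule transI) (blast intro: rtrancl_trans)
  moreover have "refl_on (labelings n) (orbit_rel n)"
    unfolding orbit_rel_def refl_on_def by blast
  moreover have "orbit_rel n \<subseteq> labelings n \<times> labelings n"
    unfolding orbit_rel_def by blast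
  ultimately show ?thesis
    by (intro equivI)
qed

end

theory Submission imports Defs
begin

text \<open>
  The augmented diagram is a tree, so the induced subgraph is a forest and its number of components
  is its number of vertices minus its number of edges.  Modulo 2 this is a quadratic form in the
  labels, and adding the sum \<open>s\<close> of the neighbouring labels to a label changes it by
  \<open>s + s * s = 0\<close>.  Conversely, moves at the vertices \<open>k, \<dots>, n\<close> suffice to clear all labels beyond
  \<open>k\<close>, provided the label of \<open>k - 1\<close> is zero.  This goes by downward induction on \<open>k\<close>: if \<open>k\<close>
  carries the label 1 and \<open>k + 1\<close> the label 0, then clearing \<open>k + 2\<close> first makes moves at
  \<open>k + 1\<close> and at \<open>k\<close> turn the label of \<open>k\<close> into 0.  For \<open>k = 1\<close> only two labelings remain.
\<close>

section \<open>Components of a forest\<close>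

text \<open>Selects one representative per component; the rank test ensures termination for
  arbitrary \<open>p\<close> and \<open>S\<close>.\<close>

function top_vertex :: "('a \<Rightarrow> nat) \<Rightarrow> ('a \<Rightarrow> 'a) \<Rightarrow> 'a set \<Rightarrow> 'a \<Rightarrow> 'a" where
  "top_vertex rk p S v = (if p v \<in> S \<and> rk (p v) < rk v then top_vertex rk p S (p v) else v)"
  by auto
termination by (relation "measure (\<lambda>(rk, p, S, v). rk v)") auto

declare top_vertex.simps [simp del]

text \<open>Each component contains exactly one vertex whose parent lies outside \<open>S\<close>:
  \<open>top_vertex\<close> is constant along edges, connects every vertex to such a root and fixes
  the roots.\<close>

lemma card_forest_components:
  fixes rk :: "'a \<Rightarrow> nat"
  assumes rk: "\<And>v. v \<in> S \<Longrightarrow> p v \<in> S \<Longrightarrow> rk (p v) < rk v"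
    and R: "R = {(u, v). u \<in> S \<and> v \<in> S \<and> (u = p v \<or> v = p u)}"
  shows "card (S // R\<^sup>*) = card {v \<in> S. p v \<notin> S}"
proof -
  let ?f = "top_vertex rk p S"
  let ?T = "{v \<in> S. p v \<notin> S}"
  have up: "?f v = ?f (p v)" if "v \<in> S" "p v \<in> S" for v
    by (subst top_vertex.simps) (use that rk in simp)
  have step: "?f u = ?f v" if "(u, v) \<in> R" for u v
    using that unfolding R by (auto intro: up up[symmetric])
  have inv: "?f u = ?f v" if "(u, v) \<in> R\<^sup>*" for u v
    using that by (induction rule: rtrancl_induct) (auto dest: step)
  have reach: "?f v \<in> ?T \<and> (v, ?f v) \<in> R\<^sup>*" if "v \<in> S" for v
    using that
  proof (induction "rk v" arbitrary: v rule: less_induct)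
    case less
    show ?case
    proof (cases "p v \<in> S")
      case True
      then have "?f (p v) \<in> ?T \<and> (p v, ?f (p v)) \<in> R\<^sup>*" "?f v = ?f (p v)"
        using less.hyps rk up less.prems by blast+
      moreover have "(v, p v) \<in> R"
        using True less.prems by (auto simp: R)
      ultimately show ?thesis
        by (metis converse_rtrancl_into_rtrancl)
    next
      case False
      then show ?thesis
        using less.prems by (auto simp: top_vertex.simps[of rk p S v])
    qed
  qed
  have "sym R"
    by (auto simp: R sym_def)
  then have sym: "sym (R\<^sup>*)"
    by (rule sym_rtrancl)
  have fT: "?f t = t" if "t \<in> ?T" for t
    using that by (simp add: top_vertex.simps[of rk p S t])
  have inj: "inj_on (\<lambda>t. R\<^sup>* `` {t}) ?T"
  proof (rule inj_onI)
    fix t u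
    assume "t \<in> ?T" "u \<in> ?T" "R\<^sup>* `` {t} = R\<^sup>* `` {u}"
    moreover from this(3) have "(t, u) \<in> R\<^sup>*"
      by blast
    ultimately show "t = u"
      using inv fT by metis
  qed
  have "(\<lambda>t. R\<^sup>* `` {t}) ` ?T = S // R\<^sup>*"
  proof (intro equalityI subsetI)
    fix C
    assume "C \<in> S // R\<^sup>*"
    then obtain v where v: "v \<in> S" "C = R\<^sup>* `` {v}"
      by (auto simp: quotient_def)
    have "(v, ?f v) \<in> R\<^sup>*" "(?f v, v) \<in> R\<^sup>*"
      using reach[OF v(1)] sym by (auto dest: symD)
    then have "C = R\<^sup>* `` {?f v}"
      unfolding v(2) by (auto intro: rtrancl_trans)
    then show "C \<in> (\<lambda>t. R\<^sup>* `` {t}) ` ?T"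
      using reach[OF v(1)] by blast
  qed (auto simp: quotient_def)
  with card_image[OF inj] show ?thesis
    by simp
qed

section \<open>The parity of the number of components\<close>

text \<open>
  The augmented diagram as a tree rooted at the boxed vertex 0, whose parent \<open>n + 1\<close> lies
  outside the diagram.
\<close>

definition parent :: "nat \<Rightarrow> nat \<Rightarrow> nat" where
  "parent n v = (if v = 0 then n + 1 else if v = n then 0 else if v = n - 1 then n - 2
     else if v = n - 2 then n else v + 1)"

text \<open>Distance to the boxed vertex in the tree; the leaf \<open>n - 1\<close> hangs below
  \<open>n - 2\<close>, so it has depth 3, like \<open>n - 3\<close>.\<close>

definition depth :: "nat \<Rightarrow> nat \<Rightarrow> nat" where
  "depth n v = (if v = 0 then 0 else if v = n then 1 else if v = n - 1 then 3 else n - v)"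

lemma depth_parent:
  assumes "n \<ge> 4" "v \<le> n" "parent n v \<le> n"
  shows "depth n (parent n v) < depth n v"
  using assms by (auto simp: parent_def depth_def split: if_splits)

lemma aug_edges_iff_parent:
  assumes "n \<ge> 4" "u \<le> n" "v \<le> n"
  shows "{u, v} \<in> aug_edges n \<longleftrightarrow> u = parent n v \<or> v = parent n u"
proof -
  have "{u, v} \<in> aug_edges n \<longleftrightarrow>
      (1 \<le> u \<and> u \<le> n - 2 \<and> v = u + 1) \<or> (1 \<le> v \<and> v \<le> n - 2 \<and> u = v + 1)
      \<or> (u = n - 2 \<and> v = n) \<or> (u = n \<and> v = n - 2) \<or> (u = 0 \<and> v = n) \<or> (u = n \<and> v = 0)"
    by (auto simp: aug_edges_def D_edges_def doubleton_eq_iff)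
  also have "\<dots> \<longleftrightarrow> u = parent n v \<or> v = parent n u"
    using assms by (auto simp: parent_def)
  finally show ?thesis .
qed

lemma card_components:
  assumes "n \<ge> 4"
  shows "card (components n a) =
    card {v \<in> one_vertices n a. parent n v \<notin> one_vertices n a}"
  unfolding components_def
proof (rule card_forest_components)
  show "depth n (parent n v) < depth n v"
    if "v \<in> one_vertices n a" "parent n v \<in> one_vertices n a" for v
    using that depth_parent[OF assms] by (auto simp: one_vertices_def)
  show "induced_adj n (one_vertices n a) = {(u, v). u \<in> one_vertices n a \<and>
      v \<in> one_vertices n a \<and> (u = parent n v \<or> v = parent n u)}"
    using aug_edges_iff_parent[OF assms] by (auto simp: induced_adj_def one_vertices_def)
qed

text \<open>Counts the tops of components mod 2: the summand of \<open>v\<close> is 1 exactly if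
  \<open>v\<close> has label 1 and its parent label 0. The leading 1 stands for the boxed
  vertex.\<close>

definition component_parity :: "nat \<Rightarrow> (nat \<Rightarrow> bit) \<Rightarrow> bit" where
  "component_parity n a =
    1 + (\<Sum>v\<in>{1..n}. aug_label a v + aug_label a v * aug_label a (parent n v))"

lemma of_nat_bit_eq_1_iff: "(of_nat m :: bit) = 1 \<longleftrightarrow> odd m"
  by (induction m) auto

lemma component_parity_eq_1_iff:
  assumes "n \<ge> 4"
  shows "component_parity n a = 1 \<longleftrightarrow> odd (card (components n a))"
proof -
  let ?S = "one_vertices n a"
  let ?g = "\<lambda>v. if v \<in> ?S \<and> parent n v \<notin> ?S then 1 else 0 :: bit"
  have "{v \<in> ?S. parent n v \<notin> ?S} = {v \<in> {0..n}. v \<in> ?S \<and> parent n v \<notin> ?S}"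
    by (auto simp: one_vertices_def)
  then have "(of_nat (card (components n a)) :: bit) = (\<Sum>v\<in>{0..n}. ?g v)"
    unfolding card_components[OF assms] by (simp add: sum.If_cases Int_def)
  also have "\<dots> = ?g 0 + (\<Sum>v\<in>{1..n}. ?g v)"
    by (simp add: sum.atLeast_Suc_atMost)
  also have "\<dots> = component_parity n a"
  proof -
    \<comment> \<open>The parent \<open>n + 1\<close> of the root lies outside the diagram, so the
      boxed vertex is always a top.\<close>
    have "?g 0 = 1"
      by (simp add: one_vertices_def parent_def aug_label_def)
    moreover have "?g v = aug_label a v + aug_label a v * aug_label a (parent n v)"
      if "v \<in> {1..n}" for v
    proof -
      have "parent n v \<le> n"
        using that assms by (auto simp: parent_def)
      then show ?thesis
        using that by (cases "aug_label a v"; cases "aug_label a (parent n v)")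
          (auto simp: one_vertices_def)
    qed
    ultimately show ?thesis
      by (simp add: component_parity_def)
  qed
  finally show ?thesis
    by (metis of_nat_bit_eq_1_iff)
qed

text \<open>Let \<open>s\<close> be the sum added at \<open>i\<close>. The linear part changes by
  \<open>s\<close>, the products by \<open>s\<close> times the neighboring labels: the edge to the
  parent sits in the summand of \<open>i\<close>, the edges to the children in theirs.\<close>

lemma component_parity_move:
  assumes n: "n \<ge> 4" and i: "i \<in> {1..n}"
  shows "component_parity n (move n i a) = component_parity n a"
proof -
  define x where "x = aug_label a"
  define s where "s = (\<Sum>j\<in>neighbors n i. x j)"
  define d where "d v = (if v = i then s else 0)" for v
  let ?p = "parent n"
  let ?V = "{1..n}"
  have x': "aug_label (move n i a) v = x v + d v" for v
    using i by (auto simp: aug_label_def move_def x_def s_def d_def)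
  have "neighbors n i = insert (?p i) {v \<in> ?V. ?p v = i}"
  proof -
    have "{i, j} \<in> aug_edges n \<longleftrightarrow> i = ?p j \<or> j = ?p i" if "j \<le> n" for j
      using aug_edges_iff_parent[OF n] that i by auto
    moreover have "?p i \<le> n" "?p 0 \<noteq> i"
      using i n by (auto simp: parent_def)
    ultimately show ?thesis
      using i by (auto simp: neighbors_def Suc_le_eq intro!: gr0I)
  qed
  moreover have "?p (?p i) \<noteq> i"
    using i n by (auto simp: parent_def)
  ultimately have s: "s = x (?p i) + (\<Sum>v | v \<in> ?V \<and> ?p v = i. x v)"
    by (simp add: s_def)
  have sd: "(\<Sum>v\<in>?V. d v) = s"
    using i by (simp add: d_def)
  have up: "(\<Sum>v\<in>?V. d v * x (?p v)) = s * x (?p i)"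
  proof -
    have "(\<Sum>v\<in>?V. d v * x (?p v)) = (\<Sum>v\<in>?V. if v = i then s * x (?p i) else 0)"
      by (rule sum.cong) (auto simp: d_def)
    then show ?thesis
      using i by simp
  qed
  have down: "(\<Sum>v\<in>?V. x v * d (?p v)) = s * (\<Sum>v | v \<in> ?V \<and> ?p v = i. x v)"
  proof -
    have "(\<Sum>v\<in>?V. x v * d (?p v)) = (\<Sum>v\<in>?V. if ?p v = i then s * x v else 0)"
      by (rule sum.cong) (auto simp: d_def)
    also have "\<dots> = (\<Sum>v | v \<in> ?V \<and> ?p v = i. s * x v)"
      by (simp add: sum.If_cases Int_def)
    finally show ?thesis
      by (simp only: sum_distrib_left)
  qed
  have expand: "(x v + d v) + (x v + d v) * (x (?p v) + d (?p v)) =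
      (x v + x v * x (?p v)) + (d v + d v * x (?p v) + x v * d (?p v))" if "v \<in> ?V" for v
  proof -
    \<comment> \<open>At most one end of an edge changes, so the cross term
      \<open>d v * d (?p v)\<close> vanishes.\<close>
    have "?p v \<noteq> v"
      using that n by (auto simp: parent_def)
    then have "d v = 0 \<or> d (?p v) = 0"
      by (auto simp: d_def)
    then show ?thesis
      by (cases "d v"; cases "d (?p v)"; cases "x v"; cases "x (?p v)") simp_all
  qed
  have "(\<Sum>v\<in>?V. (x v + d v) + (x v + d v) * (x (?p v) + d (?p v))) =
      (\<Sum>v\<in>?V. (x v + x v * x (?p v)) + (d v + d v * x (?p v) + x v * d (?p v)))"
    by (rule sum.cong[OF refl expand])
  then have "component_parity n (move n i a) =
      component_parity n a + ((\<Sum>v\<in>?V. d v) + (\<Sum>v\<in>?V. d v * x (?p v)) + (\<Sum>v\<in>?V. x v * d (?p v)))"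
    unfolding component_parity_def x' x_def[symmetric]
    by (simp only: sum.distrib add.assoc)
  also have "(\<Sum>v\<in>?V. d v) + (\<Sum>v\<in>?V. d v * x (?p v)) + (\<Sum>v\<in>?V. x v * d (?p v)) = s + s * s"
    unfolding sd up down add.assoc distrib_left[symmetric] s[symmetric] ..
  also have "s + s * s = 0"
    by (cases s) simp_all
  finally show ?thesis
    by simp
qed

lemma component_parity_orbit_rel:
  assumes "n \<ge> 4" "(a, b) \<in> orbit_rel n"
  shows "component_parity n a = component_parity n b"
proof -
  have "(a, b) \<in> (move_rel n)\<^sup>*"
    using assms(2) by (simp add: orbit_rel_def)
  then show ?thesis
    by (induction rule: rtrancl_induct)
      (auto simp: move_rel_def component_parity_move[OF assms(1)])
qed

section \<open>Reduction of labelings\<close>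

lemma move_path:
  assumes "n \<ge> 4" "1 \<le> i" "i \<le> n - 3"
  shows "move n i a = a(i := a i + ((if i = 1 then 0 else a (i - 1)) + a (i + 1)))"
proof -
  \<comment> \<open>For \<open>i = 1\<close>, \<open>i - 1\<close> is the boxed vertex, which is
    adjacent to \<open>n\<close> only.\<close>
  have "neighbors n i = (if i = 1 then {i + 1} else {i - 1, i + 1})"
    using assms by (auto simp: neighbors_def aug_edges_iff_parent parent_def split: if_splits)
  then show ?thesis
    using assms by (auto simp: move_def aug_label_def)
qed

lemma move_branch:
  assumes "n \<ge> 4"
  shows "move n (n - 2) a = a(n - 2 := a (n - 2) + (a (n - 3) + (a (n - 1) + a n)))"
proof -
  have "Suc (n - 3) = n - 2"
    using assms by simp
  then have "neighbors n (n - 2) = {n - 3, n - 1, n}"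
    using assms by (auto simp: neighbors_def aug_edges_iff_parent parent_def split: if_splits)
  moreover have "n - 3 \<noteq> n - 1" "n - 3 \<noteq> n" "n - 1 \<noteq> n"
    using assms by auto
  ultimately show ?thesis
    using assms by (simp add: move_def aug_label_def)
qed

lemma move_short_leaf:
  assumes "n \<ge> 4"
  shows "move n (n - 1) a = a(n - 1 := a (n - 1) + a (n - 2))"
proof -
  have "neighbors n (n - 1) = {n - 2}"
    using assms by (auto simp: neighbors_def aug_edges_iff_parent parent_def split: if_splits)
  then show ?thesis
    using assms by (simp add: move_def aug_label_def)
qed

lemma move_black:
  assumes "n \<ge> 4"
  shows "move n n a = a(n := a n + (a (n - 2) + 1))"
proof -
  have "neighbors n n = {n - 2, 0}"
    using assms by (auto simp: neighbors_def aug_edges_iff_parent parent_def split: if_splits)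
  then show ?thesis
    using assms by (simp add: move_def aug_label_def)
qed

section \<open>Moves at the vertices from \<open>k\<close> on\<close>

inductive_set tail_rel :: "nat \<Rightarrow> nat \<Rightarrow> ((nat \<Rightarrow> bit) \<times> (nat \<Rightarrow> bit)) set" for n k where
  tail_rel_refl [simp]: "(a, a) \<in> tail_rel n k"
| tail_rel_move: "(a, b) \<in> tail_rel n k \<Longrightarrow> b \<in> labelings n \<Longrightarrow> i \<in> {k..n} \<Longrightarrow>
    (a, move n i b) \<in> tail_rel n k"

lemma tail_rel_trans:
  assumes "(a, b) \<in> tail_rel n k" "(b, c) \<in> tail_rel n k"
  shows "(a, c) \<in> tail_rel n k"
  using assms(2,1) by induction (auto intro: tail_rel_move)

lemma tail_rel_mono:
  assumes "k \<le> l" "(a, b) \<in> tail_rel n l"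
  shows "(a, b) \<in> tail_rel n k"
  using assms(2)
proof induction
  case (tail_rel_move a b i)
  then show ?case
    using assms(1) by (intro tail_rel.tail_rel_move) auto
qed simp

lemma tail_rel_imp_move_rel:
  assumes "(a, b) \<in> tail_rel n 1"
  shows "(a, b) \<in> (move_rel n)\<^sup>*"
  using assms
proof induction
  case (tail_rel_move a b i)
  then have "(b, move n i b) \<in> move_rel n"
    unfolding move_rel_def by blast
  with tail_rel_move.IH show ?case
    by (rule rtrancl_into_rtrancl)
qed simp

lemma tail_rel_invariants:
  assumes "(a, b) \<in> tail_rel n k" "1 \<le> k" "a \<in> labelings n"
  shows "b \<in> labelings n" "j < k \<Longrightarrow> b j = a j"
proof -
  have "b \<in> labelings n \<and> (\<forall>j<k. b j = a j)"
    using assms(1,3)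
  proof induction
    case (tail_rel_move a b i)
    moreover have "move n i b j = b j" if "j < k" for j
      using tail_rel_move.hyps that by (auto simp: move_def)
    ultimately show ?case
      using assms(2) move_in_labelings[of b n i] by auto
  qed simp
  then show "b \<in> labelings n" "j < k \<Longrightarrow> b j = a j"
    by auto
qed

text \<open>The label at \<open>k\<close> itself cannot be prescribed: for
  \<open>k \<le> n - 2\<close> it is determined by the labels before \<open>k\<close> and the
  invariant parity.\<close>

definition tail_clearable :: "nat \<Rightarrow> nat \<Rightarrow> bool" where
  "tail_clearable n k \<longleftrightarrow> (\<forall>a\<in>labelings n. (k = 1 \<or> a (k - 1) = 0) \<longrightarrow>
    (\<exists>b. (a, b) \<in> tail_rel n k \<and> (\<forall>j\<in>{k<..n}. b j = 0)))"

lemma tail_clearableE: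
  assumes "tail_clearable n k" "1 \<le> k" "a \<in> labelings n" "k = 1 \<or> a (k - 1) = 0"
  obtains b where "(a, b) \<in> tail_rel n k" "b \<in> labelings n"
    "\<And>j. j < k \<Longrightarrow> b j = a j" "\<And>j. k < j \<Longrightarrow> j \<le> n \<Longrightarrow> b j = 0"
proof -
  obtain b where b: "(a, b) \<in> tail_rel n k" "\<forall>j\<in>{k<..n}. b j = 0"
    using assms(1,3,4) unfolding tail_clearable_def by blast
  show thesis
    by (rule that[OF b(1) tail_rel_invariants[OF b(1) assms(2,3)]]) (use b(2) in auto)
qed

text \<open>Slides an isolated 1 from \<open>k + 1\<close> to \<open>k\<close>.\<close>

lemma tail_slide:
  assumes n: "n \<ge> 4" and k: "1 \<le> k" "k \<le> n - 3" and a: "a \<in> labelings n"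
    and prev: "k = 1 \<or> a (k - 1) = 0" and "a k = 0"
    and zero: "\<And>j. k + 1 < j \<Longrightarrow> j \<le> n \<Longrightarrow> a j = 0"
  shows "\<exists>b. (a, b) \<in> tail_rel n k \<and> (\<forall>j\<in>{k<..n}. b j = 0)"
proof (cases "a (k + 1) = 0")
  case True
  then have "\<forall>j\<in>{k<..n}. a j = 0"
    using zero by (metis Suc_eq_plus1 Suc_lessI greaterThanAtMost_iff)
  then show ?thesis
    by (intro exI[of _ a]) simp
next
  case False
  \<comment> \<open>The only neighbor of \<open>k\<close> with label 1 is \<open>k + 1\<close>, so
    the first move sets \<open>k\<close> to 1; then \<open>k\<close> is the only such neighbor of
    \<open>k + 1\<close>, and the second move clears \<open>k + 1\<close>.\<close>
  let ?b = "move n k a"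
  let ?c = "move n (k + 1) ?b"
  have b: "?b = a(k := 1)"
    using move_path[OF n k] prev \<open>a k = 0\<close> False by auto
  have "?b (k + 1) = 1" "?b k = 1"
    using False by (auto simp: b)
  have "?c = ?b(k + 1 := 0)"
  proof (cases "k + 1 \<le> n - 3")
    case True
    then show ?thesis
      using move_path[OF n _ True, of ?b] \<open>?b (k + 1) = 1\<close> \<open>?b k = 1\<close> zero k
      by (simp add: b)
  next
    case False
    then have e: "n - 2 = k + 1" "n - 3 = k" "n - 1 = k + 2" and "k + 1 < n"
      using k n by auto
    then show ?thesis
      using move_branch[OF n, of ?b, unfolded e] \<open>?b (k + 1) = 1\<close> \<open>?b k = 1\<close> zero[of "k + 2"] zero[of n]
      by (simp add: b e)
  qed
  then have "\<forall>j\<in>{k<..n}. ?c j = 0"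
    using zero by (auto simp: b)
  moreover have "(a, ?c) \<in> tail_rel n k"
    using a k n by (intro tail_rel_move tail_rel_refl move_in_labelings) auto
  ultimately show ?thesis
    by blast
qed

text \<open>Slides an isolated 1 from \<open>j\<close> to \<open>j + 1\<close>.\<close>

lemma tail_clear_first:
  assumes n: "n \<ge> 4" and j: "2 \<le> j" "j \<le> n - 2" and a: "a \<in> labelings n"
    and prev: "a (j - 1) = 0" and clr: "tail_clearable n j"
  shows "\<exists>b. (a, b) \<in> tail_rel n j \<and> b j = 0"
proof -
  obtain b where b: "(a, b) \<in> tail_rel n j" "b \<in> labelings n"
    "\<And>i. i < j \<Longrightarrow> b i = a i" "\<And>i. j < i \<Longrightarrow> i \<le> n \<Longrightarrow> b i = 0"
    using tail_clearableE[OF clr _ a] prev j by (metis One_nat_def Suc_leD numeral_2_eq_2)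
  show ?thesis
  proof (cases "b j = 0")
    case False
    then have bj: "b j = 1"
      by simp
    \<comment> \<open>From \<open>j - 1\<close> on, only \<open>j\<close> has label 1. Hence the
      move at \<open>j + 1\<close> sets its label to 1, and this single 1 next to \<open>j\<close>
      lets the move at \<open>j\<close> clear it.\<close>
    let ?c = "move n (j + 1) b"
    let ?d = "move n j ?c"
    consider "j = n - 2" | "j = n - 3" | "j + 1 \<le> n - 3"
      using j by linarith
    then have c: "?c = b(j + 1 := 1)"
    proof cases
      case 1
      then have "n - 1 = j + 1" "n - 2 = j" "j + 1 \<le> n"
        using n by auto
      then show ?thesis
        using move_short_leaf[OF n, of b] b(4)[of "j + 1"] bj by simp
    next
      case 2
      then have e: "n - 3 = j" "n - 2 = j + 1" "n - 1 = j + 2" and "j + 3 \<le> n"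
        using n by auto
      then show ?thesis
        using move_branch[OF n, of b, unfolded e] b(4)[of "j + 1"] b(4)[of "j + 2"] b(4)[of n] bj
        by simp
    next
      case 3
      then show ?thesis
        using move_path[OF n _ 3, of b] b(4)[of "j + 1"] b(4)[of "j + 2"] bj j by simp
    qed
    have "?d j = 0"
    proof (cases "j = n - 2")
      case True
      then have e: "n - 2 = j" "n - 3 = j - 1" "n - 1 = j + 1" and "j + 2 \<le> n"
        using n by auto
      then show ?thesis
        using move_branch[OF n, of ?c, unfolded e] prev b(3)[of "j - 1"] b(4)[of n] bj j
        unfolding c by simp
    next
      case False
      then have "j \<le> n - 3"
        using j by simp
      then show ?thesis
        using move_path[OF n, of j ?c] prev b(3)[of "j - 1"] bj j unfolding c by simp
    qed
    moreover have "(a, ?d) \<in> tail_rel n j"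
      using b j n by (intro tail_rel_move move_in_labelings) auto
    ultimately show ?thesis
      by blast
  qed (use b in blast)
qed

section \<open>Downward induction on \<open>k\<close>\<close>

lemma tail_clearable_branch:
  assumes n: "n \<ge> 4"
  shows "tail_clearable n (n - 2)"
  unfolding tail_clearable_def
proof (intro ballI impI)
  fix a
  assume a: "a \<in> labelings n" and "n - 2 = 1 \<or> a (n - 2 - 1) = 0"
  then have prev: "a (n - 3) = 0"
  proof -
    have "n - 2 - 1 = n - 3" "n - 2 \<noteq> 1"
      using n by auto
    then show ?thesis
      using \<open>n - 2 = 1 \<or> a (n - 2 - 1) = 0\<close> by metis
  qed
  have ne: "n - 3 \<noteq> n - 2" "n - 3 \<noteq> n - 1" "n - 3 \<noteq> n" "n - 2 \<noteq> n - 1" "n - 2 \<noteq> n" "n - 1 \<noteq> n"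
    using n by auto
  have one: "x = 1" if "x \<noteq> 0" for x :: bit
    using that by simp
  \<comment> \<open>If \<open>n - 1\<close> and \<open>n\<close> both have label 1, one move clears
    one of them: with label 0 at \<open>n - 2\<close> the boxed 1 flips \<open>n\<close>, with label
    1 there \<open>n - 1\<close> is flipped.\<close>
  obtain b where b: "(a, b) \<in> tail_rel n (n - 2)" "b (n - 1) = 0 \<or> b n = 0"
  proof -
    let ?i = "if a (n - 2) = 0 then n else n - 1"
    have "(a, move n ?i a) \<in> tail_rel n (n - 2)"
      using a n by (intro tail_rel_move tail_rel_refl) auto
    moreover have "a (n - 1) = 0 \<or> a n = 0 \<or> move n ?i a (n - 1) = 0 \<or> move n ?i a n = 0"
      using ne by (auto simp: move_black[OF n] move_short_leaf[OF n] simp del: One_nat_def)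
    ultimately show thesis
      using that tail_rel_refl by blast
  qed
  have bl: "b \<in> labelings n" and b0: "b (n - 3) = 0"
    using tail_rel_invariants[OF b(1) _ a] prev n by auto
  have set: "{n - 2<..n} = {n - 1, n}"
    using n by auto
  show "\<exists>b. (a, b) \<in> tail_rel n (n - 2) \<and> (\<forall>j\<in>{n - 2<..n}. b j = 0)"
  proof (cases "b (n - 1) = 0 \<and> b n = 0")
    case False
    \<comment> \<open>Exactly one of \<open>n - 1\<close> and \<open>n\<close> has label 1, so a
      move at \<open>n - 2\<close> flips its label. The value \<open>b (n - 1)\<close> is what the
      last move requires: clearing \<open>n - 1\<close> takes a 1 at \<open>n - 2\<close>, clearing
      \<open>n\<close> next to the boxed 1 takes a 0.\<close>
    let ?c = "if b (n - 2) = b (n - 1) then b else move n (n - 2) b"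
    have c: "?c = b(n - 2 := b (n - 1))"
      using b(2) b0 False by (auto simp: move_branch[OF n])
    have ac: "(a, ?c) \<in> tail_rel n (n - 2)" "?c \<in> labelings n"
      using b bl n move_in_labelings tail_rel_move by auto
    let ?d = "move n (if b (n - 1) = 0 then n else n - 1) ?c"
    have "(a, ?d) \<in> tail_rel n (n - 2)"
      using ac n by (intro tail_rel_move) auto
    moreover have "?d (n - 1) = 0 \<and> ?d n = 0"
      using b(2) False ne unfolding c
      by (auto simp: move_black[OF n] move_short_leaf[OF n] simp del: One_nat_def)
    ultimately show ?thesis
      unfolding set by blast
  qed (use b set in auto)
qed

text \<open>If necessary, \<open>red\<close> puts a 1 at \<open>k + 1\<close>, so that a move at
  \<open>k\<close> removes the 1 there. Once \<open>k\<close> has label 0,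
  \<open>tail_clearable n (k + 1)\<close> applies; a 1 that survives at \<open>k + 1\<close> is
  shifted to \<open>k\<close> by \<open>tail_slide\<close>.\<close>

lemma tail_clearable_step:
  assumes n: "n \<ge> 4" and k: "1 \<le> k" "k \<le> n - 3" and clr: "tail_clearable n (k + 1)"
    and red: "\<And>a. a \<in> labelings n \<Longrightarrow> a k = 1 \<Longrightarrow> a (k + 1) = 0 \<Longrightarrow>
      \<exists>b. (a, b) \<in> tail_rel n (k + 1) \<and> b (k + 1) = 1"
  shows "tail_clearable n k"
  unfolding tail_clearable_def
proof (intro ballI impI)
  fix a
  assume a: "a \<in> labelings n" and prev: "k = 1 \<or> a (k - 1) = 0"
  obtain b where b: "(a, b) \<in> tail_rel n k" "b k = 0"
  proof (cases "a k = 0")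
    case False
    obtain c where c: "(a, c) \<in> tail_rel n (k + 1)" "c (k + 1) = 1"
      using red[OF a] False tail_rel_refl by (metis bit_not_zero_iff)
    have cl: "c \<in> labelings n" and ck: "\<And>j. j \<le> k \<Longrightarrow> c j = a j"
      using tail_rel_invariants[OF c(1) _ a] by auto
    have "(a, move n k c) \<in> tail_rel n k"
      using tail_rel_mono[OF _ c(1), of k] cl k n by (intro tail_rel_move) auto
    moreover have "move n k c k = 0"
      using ck[of "k - 1"] ck[of k] c(2) prev False by (auto simp: move_path[OF n k])
    ultimately show ?thesis
      using that by blast
  qed (use that[of a] in auto)
  have bl: "b \<in> labelings n" and bp: "k = 1 \<or> b (k - 1) = 0"
    using tail_rel_invariants[OF b(1) _ a] k prev by auto
  have "k + 1 = 1 \<or> b (k + 1 - 1) = 0"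
    using b(2) by simp
  then obtain c where c: "(b, c) \<in> tail_rel n (k + 1)" "c \<in> labelings n"
    "\<And>j. j < k + 1 \<Longrightarrow> c j = b j" "\<And>j. k + 1 < j \<Longrightarrow> j \<le> n \<Longrightarrow> c j = 0"
    using tail_clearableE[OF clr _ bl] by (metis le_add2)
  then have "\<exists>d. (c, d) \<in> tail_rel n k \<and> (\<forall>j\<in>{k<..n}. d j = 0)"
    using bp b(2) by (intro tail_slide[OF n k]) auto
  then show "\<exists>d. (a, d) \<in> tail_rel n k \<and> (\<forall>j\<in>{k<..n}. d j = 0)"
    using tail_rel_trans[OF b(1)] tail_rel_trans tail_rel_mono[OF _ c(1), of k]
    by (meson le_add1)
qed

text \<open>Here \<open>k + 2\<close> is the leaf \<open>n - 1\<close>, out of the range of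
  \<open>tail_clear_first\<close>. Instead the labels of \<open>n - 1\<close> and \<open>n\<close>
  are made equal, so that they cancel in the move at \<open>n - 2\<close>.\<close>

lemma tail_clearable_before_branch:
  assumes n: "n \<ge> 4"
  shows "tail_clearable n (n - 3)"
proof (rule tail_clearable_step[OF n])
  have e: "n - 3 + 1 = n - 2"
    using n by simp
  show "tail_clearable n (n - 3 + 1)"
    unfolding e by (rule tail_clearable_branch[OF n])
  fix a
  assume a: "a \<in> labelings n" "a (n - 3) = 1" "a (n - 3 + 1) = 0"
  \<comment> \<open>As \<open>n - 2\<close> has label 0, the boxed 1 makes the move at
    \<open>n\<close> flip its label.\<close>
  let ?b = "if a (n - 1) = a n then a else move n n a"
  have b: "?b = a(n := a (n - 1))"
    using a(3) unfolding e by (cases "a n"; cases "a (n - 1)") (auto simp: move_black[OF n])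
  have "?b \<in> labelings n" "(a, ?b) \<in> tail_rel n (n - 2)"
    using a(1) n move_in_labelings tail_rel_move[OF tail_rel_refl a(1)] by auto
  then have "(a, move n (n - 2) ?b) \<in> tail_rel n (n - 2)"
    using n by (intro tail_rel_move) auto
  moreover have "move n (n - 2) ?b (n - 2) = 1"
  proof -
    have "n - 3 \<noteq> n" "n - 1 \<noteq> n" "n - 2 \<noteq> n"
      using n by auto
    then show ?thesis
      using a(2,3) unfolding b e move_branch[OF n] by (simp add: add.assoc)
  qed
  ultimately show "\<exists>b. (a, b) \<in> tail_rel n (n - 3 + 1) \<and> b (n - 3 + 1) = 1"
    unfolding e by blast
qed (use n in auto)

text \<open>The step uses both \<open>k + 1\<close> and \<open>k + 2\<close>, hence strong induction
  with the two base cases \<open>n - 2\<close> and \<open>n - 3\<close>.\<close>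

lemma tail_clearable:
  assumes n: "n \<ge> 4" and k: "1 \<le> k" "k \<le> n - 2"
  shows "tail_clearable n k"
  using k
proof (induction "n - k" arbitrary: k rule: less_induct)
  case less
  consider "k = n - 2" | "k = n - 3" | "k + 2 \<le> n - 2"
    using less.prems by linarith
  then show ?case
  proof cases
    case 3
    show ?thesis
    proof (rule tail_clearable_step[OF n])
      show "tail_clearable n (k + 1)"
        using less 3 by simp
      fix a
      assume a: "a \<in> labelings n" "a k = 1" "a (k + 1) = 0"
      \<comment> \<open>With \<open>k + 2\<close> cleared, \<open>k\<close> is the only neighbor of
        \<open>k + 1\<close> with label 1, so the move at \<open>k + 1\<close> raises its label to
        1.\<close>
      have "tail_clearable n (k + 2)"
        using less 3 by simp
      then obtain b where b: "(a, b) \<in> tail_rel n (k + 2)" "b (k + 2) = 0"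
        using tail_clear_first[OF n, of "k + 2" a] 3 a by auto
      have bl: "b \<in> labelings n" and bk: "b k = 1" "b (k + 1) = 0"
        using tail_rel_invariants[OF b(1) _ a(1)] a by auto
      have "(a, move n (k + 1) b) \<in> tail_rel n (k + 1)"
        using tail_rel_mono[OF _ b(1), of "k + 1"] bl 3 by (intro tail_rel_move) auto
      moreover have "move n (k + 1) b (k + 1) = 1"
        using move_path[OF n, of "k + 1" b] b(2) bk less.prems 3 by simp
      ultimately show "\<exists>b. (a, b) \<in> tail_rel n (k + 1) \<and> b (k + 1) = 1"
        by blast
    qed (use less.prems 3 in auto)
  qed (use tail_clearable_branch[OF n] tail_clearable_before_branch[OF n] in auto)
qed

section \<open>The two orbits\<close>

theorem proposition10p9:
  fixes n :: nat
  assumes "n \<ge> 4"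
  shows "card (orbits n) = 2
    \<and> orbits n = {orbit n (zero_labeling n), orbit n (first_labeling n)}
    \<and> orbit n (zero_labeling n) = {a \<in> labelings n. odd (card (components n a))}
    \<and> orbit n (first_labeling n) = {a \<in> labelings n. even (card (components n a))}"
proof -
  let ?z = "zero_labeling n" and ?f = "first_labeling n"
  let ?q = "component_parity n"
  have equiv: "equiv (labelings n) (orbit_rel n)"
    using equiv_orbit_rel assms by simp
  have z: "?z \<in> labelings n" and f: "?f \<in> labelings n"
    by (auto simp: labelings_def zero_labeling_def first_labeling_def)
  have qz: "?q ?z = 1"
    by (simp add: component_parity_def aug_label_def zero_labeling_def)
  \<comment> \<open>Vertex 1 has the parent 2 with label 0, so it is the top of a second
    component.\<close>
  have qf: "?q ?f = 0"
  proof -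
    have "(\<Sum>v\<in>{1..n}. aug_label ?f v + aug_label ?f v * aug_label ?f (parent n v)) =
        (\<Sum>v\<in>{1..n}. if v = 1 then 1 else 0)"
      using assms by (intro sum.cong) (auto simp: aug_label_def first_labeling_def parent_def)
    then show ?thesis
      using assms by (simp add: component_parity_def)
  qed
  have reduce: "(a, ?z) \<in> orbit_rel n \<or> (a, ?f) \<in> orbit_rel n" if a: "a \<in> labelings n" for a
  proof -
    obtain b where b: "(a, b) \<in> tail_rel n 1" "b \<in> labelings n"
      "\<And>j. 1 < j \<Longrightarrow> j \<le> n \<Longrightarrow> b j = 0"
    proof -
      have "1 \<le> n - 2"
        using assms by simp
      then show thesis
        using tail_clearableE[OF tail_clearable[OF assms] _ a] that by blast
    qed
    have "b = (if b 1 = 0 then ?z else ?f)"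
    proof
      fix j
      consider "j = 1" | "1 < j" "j \<le> n" | "j \<notin> {1..n}"
        by (metis atLeastAtMost_iff le_neq_implies_less)
      then show "b j = (if b 1 = 0 then ?z else ?f) j"
        by cases (use b assms in
          \<open>auto simp: zero_labeling_def first_labeling_def labelings_def PiE_def extensional_def\<close>)
    qed
    then have "b = ?z \<or> b = ?f"
      by metis
    moreover have "(a, b) \<in> orbit_rel n"
      using a b tail_rel_imp_move_rel by (simp add: orbit_rel_def)
    ultimately show ?thesis
      by blast
  qed
  have sym: "(b, a) \<in> orbit_rel n" if "(a, b) \<in> orbit_rel n" for a b
    using that equiv by (auto simp: equiv_def dest: symD)
  have lab: "b \<in> labelings n" if "(a, b) \<in> orbit_rel n" for a b
    using that by (simp add: orbit_rel_def)
  \<comment> \<open>The invariant decides between the alternatives of \<open>reduce\<close>, as it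
    differs on the two representatives.\<close>
  have "(?z, a) \<in> orbit_rel n \<longleftrightarrow> a \<in> labelings n \<and> ?q a = 1"
    and "(?f, a) \<in> orbit_rel n \<longleftrightarrow> a \<in> labelings n \<and> ?q a = 0" for a
    using reduce[of a] component_parity_orbit_rel[OF assms] qz qf sym lab zero_neq_one by metis+
  then have orbit_z: "orbit n ?z = {a \<in> labelings n. ?q a = 1}"
    and orbit_f: "orbit n ?f = {a \<in> labelings n. ?q a = 0}"
    by (auto simp: orbit_def)
  have "orbits n = {orbit n ?z, orbit n ?f}"
  proof -
    have "orbit n a = orbit n ?z \<or> orbit n a = orbit n ?f" if "a \<in> labelings n" for a
      using reduce[OF that] equiv_class_eq[OF equiv] unfolding orbit_def by blast
    then show ?thesis
      using z f by (auto simp: orbits_def quotient_def orbit_def)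
  qed
  moreover have "orbit n ?z \<noteq> orbit n ?f"
  proof -
    have "?z \<in> orbit n ?z" "?z \<notin> orbit n ?f"
      using z qz by (simp_all add: orbit_z orbit_f)
    then show ?thesis
      by metis
  qed
  moreover have "?q a = 1 \<longleftrightarrow> odd (card (components n a))"
    and "?q a = 0 \<longleftrightarrow> even (card (components n a))" for a
    using component_parity_eq_1_iff[OF assms, of a] by auto
  ultimately show ?thesis
    using orbit_z orbit_f by simp
qed

end
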